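(* Let $d\ge1$ be an integer and let $\Omega\subseteq\mathbb{R}^d$ be a locally compact set. For a typical continuous function $f\colon\Omega\to\mathbb{R}$ there are sets $A\subseteq\Omega$ and $B\subseteq\mathbb{R}$ such that (i) $A$ is $\sigma$-strongly porous in $\mathbb{R}^d$ and the lower packing dimension of $A$ satisfies $\underline{\dim}_{\mathsf P}A\le d-1$; (ii) the Hausdorff dimension of $B$ is zero; (iii) the graph of $f$ is contained in $(A\times\mathbb{R})\cup(\Omega\times B)$.
   Context: $C(\Omega)$, the space of continuous real functions on $\Omega$, carries the compact-open topology. "For a typical $f$ ... holds" means: there is a comeager set $\mathcal{F}\subseteq C(\Omega)$ such that every $f\in\mathcal{F}$ has the property. $B(x,r)$ denotes a closed ball. Strong porosity: for a subset $E$ of a metric space $X$, $x\in E$, $r>0$, let $\gamma(E,x,r)=\sup\{s:\exists y\in B(x,r)\ B(y,s)\cap E=\emptyset\}$ (with $\sup\emptyset=0$; balls in $X$) and $\mathsf{por}(E,x)=\limsup_{r\to0}\gamma(E,x,r)/r$. $E$ is strongly porous if $\mathsf{por}(E,x)=1$ for every $x\in E$; $E$ is $\sigma$-strongly porous if it is a countable union of strongly porous sets. Lower packing dimension: for $\delta>0$ let $N_\delta(E)$ be the least number of sets of diameter at most $\delta$ needed to cover $E$. For $s>0$ let $\boldsymbol{\nu}^s_0(E)=\liminf_{\delta\to0}N_\delta(E)\delta^s$ and $\boldsymbol{\nu}^s(E)=\inf\{\sum_n\boldsymbol{\nu}^s_0(E_n):\{E_n\}\text{ a countable cover of }E\}$.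 Then $\underline{\dim}_{\mathsf P}E=\sup\{s>0:\boldsymbol{\nu}^s(E)>0\}$ ($\sup\emptyset=0$). Hausdorff dimension is the usual one (the empty set has dimension $0$). *)

theory Defs
  imports "HOL-Analysis.Analysis"
begin

text \<open>
  A function on \<open>\<Omega>\<close> is represented by an element of \<open>extensional \<Omega>\<close>, so that two members of
  \<open>cont_funs \<Omega>\<close> are equal iff they agree on \<open>\<Omega>\<close>.
\<close>

definition cont_funs :: "'a::topological_space set \<Rightarrow> ('a \<Rightarrow> 'b::topological_space) set" where
  "cont_funs \<Omega> = {f \<in> extensional \<Omega>. continuous_on \<Omega> f}"

definition compact_open_topology ::
  "'a::topological_space set \<Rightarrow> ('a \<Rightarrow> 'b::topological_space) topology" where
  "compact_open_topology \<Omega> =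
     topology_generated_by
       {{f \<in> cont_funs \<Omega>. f ` K \<subseteq> U} | K U. compact K \<and> K \<subseteq> \<Omega> \<and> open U}"

lemma topspace_compact_open_topology [simp]:
  "topspace (compact_open_topology \<Omega>) = cont_funs \<Omega>"
proof -
  have "cont_funs \<Omega> \<in> {{f \<in> cont_funs \<Omega>. f ` K \<subseteq> U} | K U. compact K \<and> K \<subseteq> \<Omega> \<and> open U}"
    by (rule CollectI, rule exI[of _ "{}"], rule exI[of _ UNIV]) auto
  then show ?thesis
    unfolding compact_open_topology_def topology_generated_by_topspace by blast
qed

definition nowhere_dense_in :: "'a topology \<Rightarrow> 'a set \<Rightarrow> bool" where
  "nowhere_dense_in X S \<longleftrightarrow> S \<subseteq> topspace X \<and> X interior_of (X closure_of S) = {}"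

definition meager_in :: "'a topology \<Rightarrow> 'a set \<Rightarrow> bool" where
  "meager_in X S \<longleftrightarrow> (\<exists>\<N>. countable \<N> \<and> (\<forall>N\<in>\<N>. nowhere_dense_in X N) \<and> S = \<Union>\<N>)"

definition comeager_in :: "'a topology \<Rightarrow> 'a set \<Rightarrow> bool" where
  "comeager_in X S \<longleftrightarrow> S \<subseteq> topspace X \<and> meager_in X (topspace X - S)"

text \<open>
  The ambient metric space is the whole type. Inserting \<open>0\<close> implements the convention
  \<open>sup \<emptyset> = 0\<close>; only radii \<open>s > 0\<close> are considered, as \<^term>\<open>cball y s\<close> is empty for
  \<open>s < 0\<close>.
\<close>

definition hole_size :: "'a::metric_space set \<Rightarrow> 'a \<Rightarrow> real \<Rightarrow> ereal" where
  "hole_size E x r =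
     Sup (insert 0 (ereal ` {s. 0 < s \<and> (\<exists>y\<in>cball x r. cball y s \<inter> E = {})}))"

definition porosity :: "'a::metric_space set \<Rightarrow> 'a \<Rightarrow> ereal" where
  "porosity E x = Limsup (at_right 0) (\<lambda>r. hole_size E x r / ereal r)"

definition strongly_porous :: "'a::metric_space set \<Rightarrow> bool" where
  "strongly_porous E \<longleftrightarrow> (\<forall>x\<in>E. porosity E x = 1)"

definition sigma_strongly_porous :: "'a::metric_space set \<Rightarrow> bool" where
  "sigma_strongly_porous E \<longleftrightarrow>
     (\<exists>\<C>. countable \<C> \<and> (\<forall>C\<in>\<C>. strongly_porous C) \<and> E = \<Union>\<C>)"

text \<open>
  In all covers below, \<open>bounded\<close> is required explicitly because \<^const>\<open>diameter\<close> is a real number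
  and carries no information for an unbounded set. Countable covers are indexed by \<^typ>\<open>nat\<close>;
  finite ones are padded with empty sets, which contribute \<open>0\<close> to the sums.
\<close>

definition covering_number :: "real \<Rightarrow> 'a::metric_space set \<Rightarrow> ennreal" where
  "covering_number \<delta> E =
     (INF \<C> \<in> {\<C>. finite \<C> \<and> E \<subseteq> \<Union>\<C> \<and> (\<forall>C\<in>\<C>. bounded C \<and> diameter C \<le> \<delta>)}.
        of_nat (card \<C>))"

definition lower_box_premeasure :: "real \<Rightarrow> 'a::metric_space set \<Rightarrow> ennreal" where
  "lower_box_premeasure s E =
     Liminf (at_right 0) (\<lambda>\<delta>. covering_number \<delta> E * ennreal (\<delta> powr s))"

definition lower_packing_measure :: "real \<Rightarrow> 'a::metric_space set \<Rightarrow> ennreal" where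
  "lower_packing_measure s E =
     (INF F \<in> {F :: nat \<Rightarrow> 'a set. E \<subseteq> (\<Union>n. F n)}. \<Sum>n. lower_box_premeasure s (F n))"

definition lower_packing_dim :: "'a::metric_space set \<Rightarrow> ereal" where
  "lower_packing_dim E = Sup (insert 0 (ereal ` {s. 0 < s \<and> lower_packing_measure s E > 0}))"

definition hausdorff_premeasure :: "real \<Rightarrow> real \<Rightarrow> 'a::metric_space set \<Rightarrow> ennreal" where
  "hausdorff_premeasure s \<delta> E =
     (INF F \<in> {F :: nat \<Rightarrow> 'a set. E \<subseteq> (\<Union>n. F n) \<and> (\<forall>n. bounded (F n) \<and> diameter (F n) \<le> \<delta>)}.
        \<Sum>n. ennreal (diameter (F n) powr s))"

definition hausdorff_measure :: "real \<Rightarrow> 'a::metric_space set \<Rightarrow> ennreal" where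
  "hausdorff_measure s E = (SUP \<delta> \<in> {0<..}. hausdorff_premeasure s \<delta> E)"

text \<open>
  The exponent \<open>s = 0\<close> is excluded since \<^term>\<open>0 powr 0 = (0::real)\<close>. This does not affect the
  infimum, which is \<open>0\<close> for the empty set and \<open>\<infinity>\<close> if no exponent gives measure zero.
\<close>

definition hausdorff_dim :: "'a::metric_space set \<Rightarrow> ereal" where
  "hausdorff_dim E = Inf (ereal ` {s. 0 < s \<and> hausdorff_measure s E = 0})"

end

(*
  Typical functions are close to step functions: for every n there are a mesh eta, chosen by f, and a
  finite set V such that off a neighbourhood of the coordinate grid of mesh eta, of width
  eta^(1 + n d), f takes values extremely close to V. Let B be the set of reals that are infinitely often
  this close to V; it has Hausdorff dimension zero. A point x with f x outside B lies in all
  but finitely many of the grid neighbourhoods, which are so thin that they have cheap covers at the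
  scale of their width; this bounds the lower packing dimension.

  A grid neighbourhood is porous near the middle of a face but not near an edge, where several
  coordinates are close to the grid. Hence the widths eta^(1 + n (d + 1 - k)), k = 1, ..., d + 1,
  with consecutive ratios eta^n tending to 0: if exactly k coordinates of x are within the k-th
  width of the grid, and no others within the (k+1)-st, then there is a hole of relative size close to 1.
*)
theory Submission
  imports Defs
begin

section \<open>Exhaustion of locally compact sets by compact sets\<close>

text \<open>Such a set is the intersection of a closed and an open set; a compact exhaustion of the
  open set, cut with the closed one, works. It is increasing so that each point lies in all but
  finitely many of its members.\<close>

lemma sigma_compact_if_locally_compact:
  fixes S :: "'a::euclidean_space set"
  assumes "locally compact S"
  obtains K where "\<And>n. compact (K n)" "incseq K" "(\<Union>n. K n) = S"
proof -
  obtain U V where UV: "closed U" "open V" "S = U \<inter> V"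
    using assms unfolding locally_compact_closed_Int_open[of S] by (elim exE conjE)
  obtain C where C: "\<And>n. compact (C n)" "\<And>n::nat. C n \<subseteq> interior (C (Suc n))" "\<Union>(range C) = V"
    using open_Union_compact_subsets[OF UV(2)] by metis
  show thesis
  proof
    show "compact (U \<inter> C n)" for n
      using C(1) UV(1) by (simp add: closed_Int_compact)
    show "incseq (\<lambda>n. U \<inter> C n)"
      using C(2) interior_subset by (intro incseq_SucI) blast
    show "(\<Union>n. U \<inter> C n) = S"
      using C(3) UV(3) by auto
  qed
qed

section \<open>Neighbourhoods of the coordinate grid\<close>

text \<open>The strict inequality makes level 1 below an open set, so that removing it from a
  compact set leaves a compact set.\<close>

definition near_grid :: "real \<Rightarrow> real \<Rightarrow> real ^ 'd \<Rightarrow> 'd \<Rightarrow> bool" where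
  "near_grid \<eta> \<tau> x i \<longleftrightarrow> (\<exists>k::int. \<bar>x $ i - \<eta> * of_int k\<bar> < \<tau>)"

text \<open>For \<tau> > 0 this is the sup-norm neighbourhood of radius \<tau> of the grid faces of
  codimension \<open>k\<close>. Level 1 surrounds the whole grid; levels above the dimension are
  empty.\<close>

definition grid_level :: "real \<Rightarrow> real \<Rightarrow> nat \<Rightarrow> (real ^ 'd) set" where
  "grid_level \<eta> \<tau> k = {x. k \<le> card {i. near_grid \<eta> \<tau> x i}}"

lemma mem_grid_level_1: "x \<in> grid_level \<eta> \<tau> (Suc 0) \<longleftrightarrow> (\<exists>i. near_grid \<eta> \<tau> x i)"
  unfolding grid_level_def by (auto simp: Suc_le_eq card_gt_0_iff)

lemma open_grid_level_1: "open (grid_level \<eta> \<tau> (Suc 0) :: (real ^ 'd) set)"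
proof -
  have eq: "grid_level \<eta> \<tau> (Suc 0) =
      (\<Union>i. \<Union>k::int. {x :: real ^ 'd. \<bar>x $ i - \<eta> * of_int k\<bar> < \<tau>})"
    unfolding set_eq_iff mem_grid_level_1 near_grid_def by simp
  show ?thesis
    unfolding eq by (intro open_UN ballI open_Collect_less continuous_intros)
qed

section \<open>Neighbourhoods in the compact-open topology\<close>

text \<open>Induction over the generation of the topology. For a subbasic set, a uniform
  neighbourhood of the compact image of \<open>K\<close> stays inside \<open>U\<close>; an
  intersection takes the union of the compact sets and the smaller radius.\<close>

lemma compact_open_nbhd:
  assumes "openin (compact_open_topology \<Omega>) T" and "f \<in> T"
  obtains K \<epsilon> where "compact K" "K \<subseteq> \<Omega>" "0 < \<epsilon>"
    "\<And>g. g \<in> cont_funs \<Omega> \<Longrightarrow> (\<And>x. x \<in> K \<Longrightarrow> dist (g x) (f x) < \<epsilon>) \<Longrightarrow> g \<in> T"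
proof -
  define P where "P T K \<epsilon> \<longleftrightarrow> compact K \<and> K \<subseteq> \<Omega> \<and> 0 < \<epsilon> \<and>
      (\<forall>g\<in>cont_funs \<Omega>. (\<forall>x\<in>K. dist (g x) (f x) < \<epsilon>) \<longrightarrow> g \<in> T)" for T and K and \<epsilon> :: real
  \<comment> \<open>Membership of \<open>f\<close> is a premise inside the induction, since a union
    may have members without \<open>f\<close>.\<close>
  have "f \<in> T \<longrightarrow> (\<exists>K \<epsilon>. P T K \<epsilon>)"
    using openin_topology_generated_by[OF assms(1)[unfolded compact_open_topology_def]]
  proof (induction rule: generate_topology_on.induct)
    case Empty
    then show ?case by simp
  next
    case (Int a b)
    show ?case
    proof
      assume "f \<in> a \<inter> b"
      with Int.IH obtain K1 e1 K2 e2 where 1: "P a K1 e1" and 2: "P b K2 e2" by blast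
      have "P (a \<inter> b) (K1 \<union> K2) (min e1 e2)"
        using 1 2 unfolding P_def by (auto simp: compact_Un)
      then show "\<exists>K \<epsilon>. P (a \<inter> b) K \<epsilon>" by blast
    qed
  next
    case (UN \<K>)
    show ?case
    proof
      assume "f \<in> \<Union>\<K>"
      then obtain k where k: "k \<in> \<K>" "f \<in> k" by blast
      with UN.IH obtain K e where "P k K e" by blast
      with k(1) have "P (\<Union>\<K>) K e" unfolding P_def by blast
      then show "\<exists>K \<epsilon>. P (\<Union>\<K>) K \<epsilon>" by blast
    qed
  next
    case (Basis s)
    then obtain K U where s: "s = {f \<in> cont_funs \<Omega>. f ` K \<subseteq> U}" "compact K" "K \<subseteq> \<Omega>" "open U"
      by blast
    show ?case
    proof
      assume "f \<in> s"
      then have "continuous_on K f" "f ` K \<subseteq> U"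
        using s continuous_on_subset by (auto simp: cont_funs_def)
      then obtain e where e: "e > 0" "(\<Union>x\<in>f ` K. ball x e) \<subseteq> U"
        using compact_subset_open_imp_ball_epsilon_subset[OF compact_continuous_image] s by metis
      have "P s K e"
        using s e unfolding P_def by (force simp: dist_commute)
      then show "\<exists>K \<epsilon>. P s K \<epsilon>" by blast
    qed
  qed
  then obtain K \<epsilon> where "P T K \<epsilon>" using assms(2) by blast
  then show thesis using that[of K \<epsilon>] by (simp add: P_def)
qed

section \<open>Approximation by functions with finitely many values off the grid\<close>

text \<open>If the cells differ in coordinate \<open>i\<close>, a grid value separates the two
  coordinates, and each of them is then closer than \<tau> to it.\<close>

lemma floor_eq_off_grid:
  fixes x y :: "real ^ 'd"
  assumes "0 < \<eta>" "x \<notin> grid_level \<eta> \<tau> (Suc 0)" "y \<notin> grid_level \<eta> \<tau> (Suc 0)" "dist x y < \<tau>"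
  shows "\<lfloor>x $ i / \<eta>\<rfloor> = \<lfloor>y $ i / \<eta>\<rfloor>"
proof -
  have *: "\<not> \<lfloor>u $ i / \<eta>\<rfloor> < \<lfloor>v $ i / \<eta>\<rfloor>"
    if "u \<notin> grid_level \<eta> \<tau> (Suc 0)" "v \<notin> grid_level \<eta> \<tau> (Suc 0)" "dist u v < \<tau>" for u v :: "real ^ 'd"
  proof
    assume "\<lfloor>u $ i / \<eta>\<rfloor> < \<lfloor>v $ i / \<eta>\<rfloor>"
    then have "u $ i / \<eta> < of_int \<lfloor>v $ i / \<eta>\<rfloor>" by (simp add: floor_less_iff)
    then have "u $ i < \<eta> * of_int \<lfloor>v $ i / \<eta>\<rfloor>" using assms(1) by (simp add: field_simps)
    moreover have "of_int \<lfloor>v $ i / \<eta>\<rfloor> \<le> v $ i / \<eta>" by simp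
    then have "\<eta> * of_int \<lfloor>v $ i / \<eta>\<rfloor> \<le> v $ i"
      using assms(1) by (simp only: pos_le_divide_eq mult.commute)
    moreover have "\<bar>u $ i - v $ i\<bar> < \<tau>"
      using dist_vec_nth_le[of u i v] that(3) by (simp add: dist_real_def)
    ultimately have "\<bar>u $ i - \<eta> * of_int \<lfloor>v $ i / \<eta>\<rfloor>\<bar> < \<tau>" by linarith
    then have "near_grid \<eta> \<tau> u i" unfolding near_grid_def by blast
    then show False using that(1) mem_grid_level_1 by blast
  qed
  show ?thesis
    using *[of x y] *[of y x] assms by (simp add: dist_commute)
qed

lemma dist_le_same_cell:
  fixes x y :: "real ^ 'd"
  assumes "0 < \<eta>" "\<And>i. \<lfloor>x $ i / \<eta>\<rfloor> = \<lfloor>y $ i / \<eta>\<rfloor>"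
  shows "dist x y \<le> real CARD('d) * \<eta>"
proof -
  have "\<bar>(x - y) $ i\<bar> \<le> \<eta>" for i
  proof -
    have "\<bar>x $ i / \<eta> - y $ i / \<eta>\<bar> \<le> 1" using assms(2)[of i] by linarith
    then have "\<bar>x $ i - y $ i\<bar> / \<eta> \<le> 1" using assms(1)
      by (simp add: diff_divide_distrib[symmetric])
    then show ?thesis using assms(1) by (simp add: field_simps)
  qed
  then have "(\<Sum>i\<in>UNIV. \<bar>(x - y) $ i\<bar>) \<le> (\<Sum>i\<in>(UNIV::'d set). \<eta>)"
    by (intro sum_mono)
  then show ?thesis
    using norm_le_l1_cart[of "x - y"] by (simp add: dist_norm)
qed

text \<open>The mesh is so small that \<open>f\<close> varies by less than \<epsilon>/2 on a cell.
  Off the grid neighbourhood a step function close to \<open>f\<close> is locally constant, hence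
  continuous, and Tietze extends its difference from \<open>f\<close>. The mesh is fixed before
  \<tau>, because \<tau> will be a power of it.\<close>

lemma approx_finite_valued_off_grid:
  fixes f :: "real ^ 'd \<Rightarrow> real"
  assumes "compact C" "C \<subseteq> \<Omega>" "continuous_on \<Omega> f" "0 < \<epsilon>" "0 < \<eta>\<^sub>0"
  obtains \<eta> where "0 < \<eta>" "\<eta> \<le> \<eta>\<^sub>0"
    "\<forall>\<tau>>0. \<exists>g\<in>cont_funs \<Omega>. finite (g ` (C - grid_level \<eta> \<tau> (Suc 0))) \<and>
       (\<forall>x\<in>C. dist (g x) (f x) < \<epsilon>)"
proof -
  have "uniformly_continuous_on C f"
    using assms by (meson compact_uniformly_continuous continuous_on_subset)
  then obtain d where d: "d > 0" "\<And>x y. x \<in> C \<Longrightarrow> y \<in> C \<Longrightarrow> dist x y < d \<Longrightarrow> dist (f x) (f y) < \<epsilon> / 2"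
    using assms(4) unfolding uniformly_continuous_on_def by (metis half_gt_zero)
  define \<eta> where "\<eta> = min \<eta>\<^sub>0 (d / (2 * real CARD('d)))"
  have \<eta>: "0 < \<eta>" "\<eta> \<le> \<eta>\<^sub>0" using d(1) assms(5) by (auto simp: \<eta>_def)
  have "real CARD('d) * \<eta> \<le> real CARD('d) * (d / (2 * real CARD('d)))"
    unfolding \<eta>_def by (intro mult_left_mono) auto
  then have \<eta>d: "real CARD('d) * \<eta> < d" using d(1) by simp
  define cell :: "real ^ 'd \<Rightarrow> 'd \<Rightarrow> int" where "cell x = (\<lambda>i. \<lfloor>x $ i / \<eta>\<rfloor>)" for x
  show thesis
  proof
    show "0 < \<eta>" "\<eta> \<le> \<eta>\<^sub>0" by fact+
  next
    show "\<forall>\<tau>>0. \<exists>g\<in>cont_funs \<Omega>. finite (g ` (C - grid_level \<eta> \<tau> (Suc 0))) \<and>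
        (\<forall>x\<in>C. dist (g x) (f x) < \<epsilon>)"
    proof (intro allI impI)
      fix \<tau> :: real assume \<tau>: "0 < \<tau>"
      define C' where "C' = C - grid_level \<eta> \<tau> (Suc 0)"
      have C': "compact C'" "C' \<subseteq> C"
        using compact_diff[OF assms(1) open_grid_level_1] by (auto simp: C'_def)
      \<comment> \<open>The chosen point depends only on the cell of \<open>x\<close> and lies in
        \<open>C'\<close>, where the estimate for \<open>f\<close> is available.\<close>
      define p where "p x = (SOME y. y \<in> C' \<and> cell y = cell x)" for x
      define h where "h x = f (p x)" for x
      have p: "p x \<in> C'" "cell (p x) = cell x" if "x \<in> C'" for x
        using someI[of "\<lambda>y. y \<in> C' \<and> cell y = cell x" x] that by (auto simp: p_def)
      have hf: "dist (h x) (f x) < \<epsilon> / 2" if "x \<in> C'" for x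
      proof -
        have "dist (p x) x \<le> real CARD('d) * \<eta>"
          using p(2)[OF that] \<eta>(1) by (intro dist_le_same_cell) (auto simp: cell_def fun_eq_iff)
        then show ?thesis
          unfolding h_def using \<eta>d p(1)[OF that] that C'(2) by (intro d(2)) auto
      qed
      have loc: "h x = h y" if "x \<in> C'" "y \<in> C'" "dist x y < \<tau>" for x y
      proof -
        have "cell x = cell y"
          using floor_eq_off_grid[OF \<eta>(1)] that unfolding cell_def C'_def by blast
        then show ?thesis by (simp add: h_def p_def)
      qed
      have cont_h: "continuous_on C' h"
        unfolding continuous_on_iff using loc \<tau> by (metis dist_self)
      have fin: "finite (h ` C')"
      proof -
        obtain F where F: "finite F" "F \<subseteq> C'" "C' \<subseteq> (\<Union>x\<in>F. ball x \<tau>)"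
          using compactE_image[OF C'(1), of C' "\<lambda>x. ball x \<tau>"] \<tau> by (metis UN_I centre_in_ball open_ball subsetI)
        have "h ` C' \<subseteq> h ` F"
        proof
          fix z assume "z \<in> h ` C'"
          then obtain x where x: "x \<in> C'" "z = h x" by blast
          then obtain y where y: "y \<in> F" "dist y x < \<tau>" using F(3) by auto
          have "h y = h x" using loc[of y x] x(1) y F(2) by auto
          with x(2) y(1) show "z \<in> h ` F" by (metis image_eqI)
        qed
        then show ?thesis using F(1) by (rule finite_surj[rotated])
      qed
      \<comment> \<open>Extending \<open>h - f\<close> rather than \<open>h\<close> preserves the
        bound \<epsilon>/2, so \<open>f + e\<close> is close to \<open>f\<close> also inside the
        grid neighbourhood.\<close>
      have "closedin (top_of_set \<Omega>) C'"
        using C' assms(2) by (meson closed_subset compact_imp_closed order_trans)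
      moreover have "continuous_on C' (\<lambda>x. h x - f x)"
        using C' assms cont_h by (intro continuous_intros) (auto intro: continuous_on_subset)
      moreover have "\<And>x. x \<in> C' \<Longrightarrow> norm (h x - f x) \<le> \<epsilon> / 2"
        using hf by (simp add: dist_real_def less_imp_le)
      ultimately obtain e where e: "continuous_on \<Omega> e" "\<And>x. x \<in> C' \<Longrightarrow> e x = h x - f x"
        "\<And>x. x \<in> \<Omega> \<Longrightarrow> norm (e x) \<le> \<epsilon> / 2"
        using assms(4) Tietze[of C' "\<lambda>x. h x - f x" \<Omega> "\<epsilon> / 2"]
        by (metis (no_types, lifting) half_gt_zero less_imp_le)
      define g where "g = restrict (\<lambda>x. f x + e x) \<Omega>"
      have "continuous_on \<Omega> (\<lambda>x. f x + e x)"
        using e(1) assms(3) by (intro continuous_intros)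
      then have "continuous_on \<Omega> g"
        by (rule continuous_on_eq) (simp add: g_def)
      then have "g \<in> cont_funs \<Omega>" by (simp add: cont_funs_def g_def)
      moreover have "g ` C' = h ` C'"
        using C' assms(2) e(2) by (intro image_cong) (auto simp: g_def)
      moreover have "dist (g x) (f x) < \<epsilon>" if "x \<in> C" for x
        using e(3)[of x] that assms(2,4) by (auto simp: g_def dist_real_def)
      ultimately show "\<exists>g\<in>cont_funs \<Omega>. finite (g ` (C - grid_level \<eta> \<tau> (Suc 0))) \<and> (\<forall>x\<in>C. dist (g x) (f x) < \<epsilon>)"
        using fin unfolding C'_def[symmetric] by (intro bexI[of _ g]) simp_all
    qed
  qed
qed

section \<open>Comeager sets from dense open sets\<close>

text \<open>The complement of \<open>G n\<close> is its own closure, and it contains no nonempty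
  open set because each such set meets \<open>G n\<close>.\<close>

lemma comeager_in_INT:
  assumes "\<And>n::nat. openin X (G n)"
    and "\<And>n T. openin X T \<Longrightarrow> T \<noteq> {} \<Longrightarrow> T \<inter> G n \<noteq> {}"
  shows "comeager_in X (\<Inter>n. G n)"
  unfolding comeager_in_def
proof
  show "(\<Inter>n. G n) \<subseteq> topspace X"
    using openin_subset[OF assms(1)] by blast
  have "nowhere_dense_in X (topspace X - G n)" for n
  proof -
    have "X closure_of (topspace X - G n) = topspace X - G n"
      using assms(1)[of n] by (simp add: closure_of_eq openin_closedin_eq)
    moreover have "X interior_of (topspace X - G n) = {}"
      unfolding interior_of_eq_empty using assms(2) by (meson Diff_disjoint disjoint_iff subsetD)
    ultimately show ?thesis by (simp add: nowhere_dense_in_def)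
  qed
  then show "meager_in X (topspace X - (\<Inter>n. G n))"
    unfolding meager_in_def by (intro exI[of _ "range (\<lambda>n. topspace X - G n)"]) auto
qed

section \<open>Strong porosity\<close>

text \<open>A ball that misses \<open>E\<close> does not contain \<open>x\<close>, so its radius is
  less than the distance from its centre to \<open>x\<close>, which is at most
  \<open>r\<close>.\<close>

lemma porosity_le_1:
  assumes "x \<in> E"
  shows "porosity E x \<le> 1"
  unfolding porosity_def
proof (rule Limsup_bounded)
  have "hole_size E x r / ereal r \<le> 1" if "0 < r" for r
  proof -
    have "hole_size E x r \<le> ereal r"
      unfolding hole_size_def
    proof (rule Sup_least, safe)
      show "0 \<le> ereal r" using that by simp
      fix s y assume y: "y \<in> cball x r" "cball y s \<inter> E = {}"
      then have "x \<notin> cball y s" using assms by blast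
      with y(1) have "s < dist y x" "dist y x \<le> r" by (auto simp: dist_commute)
      then show "ereal s \<le> ereal r" by simp
    qed
    then show ?thesis using that by (simp add: ereal_divide_le_pos one_ereal_def)
  qed
  then show "\<forall>\<^sub>F r in at_right 0. hole_size E x r / ereal r \<le> 1"
    by (simp add: eventually_at_filter)
qed

text \<open>As porosity never exceeds 1 on the set, nearly full holes at arbitrarily small radii
  suffice. A single \<epsilon> bounds both the radius and the relative loss.\<close>

lemma strongly_porousI:
  assumes "\<And>x \<epsilon>. x \<in> E \<Longrightarrow> 0 < \<epsilon> \<Longrightarrow>
    \<exists>r s y. 0 < r \<and> r < \<epsilon> \<and> y \<in> cball x r \<and> (1 - \<epsilon>) * r \<le> s \<and> cball y s \<inter> E = {}"
  shows "strongly_porous E"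
  unfolding strongly_porous_def
proof
  fix x assume x: "x \<in> E"
  have "1 \<le> porosity E x"
    unfolding porosity_def
  proof (rule Limsup_greatest, rule dense_le)
    fix P and c :: ereal assume P: "\<forall>\<^sub>F r in at_right 0. P (r::real)" and c: "c < 1"
    obtain b where b: "b > 0" "\<And>r. 0 < r \<Longrightarrow> r < b \<Longrightarrow> P r"
      using P unfolding eventually_at_right_field by auto
    \<comment> \<open>\<open>c\<close> may be minus infinity; then 0 serves as
      \<open>q\<close>.\<close>
    obtain q :: real where q: "c \<le> ereal q" "q < 1"
      using c by (cases c) (auto intro: that[of 0])
    \<comment> \<open>The bound \<open>b\<close> puts the radius in the range of \<open>P\<close>,
      \<open>1 - q\<close> gives a ratio of at least \<open>q\<close>, and 1/2 keeps
      \<open>s\<close> positive, as \<open>hole_size\<close> requires.\<close>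
    define \<epsilon> where "\<epsilon> = min b (min (1 - q) (1/2))"
    have \<epsilon>: "0 < \<epsilon>" "\<epsilon> \<le> b" "\<epsilon> \<le> 1 - q" "\<epsilon> \<le> 1/2" using b(1) q(2) by (auto simp: \<epsilon>_def min_def)
    obtain r s y where r: "0 < r" "r < \<epsilon>" "y \<in> cball x r" "(1 - \<epsilon>) * r \<le> s" "cball y s \<inter> E = {}"
      using assms[OF x \<epsilon>(1)] by blast
    have "0 < (1 - \<epsilon>) * r" using r(1) \<epsilon>(4) by simp
    then have "0 < s" using r(4) by linarith
    with r have "s \<in> {s. 0 < s \<and> (\<exists>y\<in>cball x r. cball y s \<inter> E = {})}" by blast
    then have "ereal s \<le> hole_size E x r"
      unfolding hole_size_def by (intro Sup_upper insertI2 imageI)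
    moreover have "q * r \<le> s"
      using mult_right_mono[of q "1 - \<epsilon>" r] r \<epsilon> by linarith
    ultimately have "ereal q * ereal r \<le> hole_size E x r"
      by (simp add: order_trans[of "ereal (q * r)" "ereal s"])
    then have "ereal q \<le> hole_size E x r / ereal r"
      using r(1) by (simp add: ereal_le_divide_pos mult.commute)
    also have "\<dots> \<le> (SUP r\<in>Collect P. hole_size E x r / ereal r)"
      using b(2) r \<epsilon> by (intro SUP_upper) auto
    finally show "c \<le> (SUP r\<in>Collect P. hole_size E x r / ereal r)"
      using q(1) by (rule order_trans[rotated])
  qed
  with porosity_le_1[OF x] show "porosity E x = 1" by (rule antisym)
qed

text \<open>
  The \<open>k\<close> coordinates close to the grid at scale \<open>\<tau>\<close> are the only ones close to it at scale \<open>\<tau>'\<close>. Moving one of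
  them away by \<open>\<tau>' / 4\<close> therefore leaves the grid level on a ball of almost that radius.
\<close>

lemma grid_level_hole:
  fixes x :: "real ^ 'd"
  assumes "0 < \<tau>" "8 * \<tau> \<le> \<tau>'" "\<tau>' \<le> \<eta>" "0 < k"
    and x: "x \<in> grid_level \<eta> \<tau> k" "x \<notin> grid_level \<eta> \<tau>' (Suc k)"
  shows "\<exists>y\<in>cball x (\<tau>' / 4). cball y (\<tau>' / 4 - 2 * \<tau>) \<inter> grid_level \<eta> \<tau> k = {}"
proof -
  define I where "I = {i. near_grid \<eta> \<tau> x i}"
  have sub: "I \<subseteq> {i. near_grid \<eta> \<tau>' x i}"
  proof
    fix j assume "j \<in> I"
    then obtain m :: int where "\<bar>x $ j - \<eta> * m\<bar> < \<tau>" unfolding I_def near_grid_def by blast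
    then have "\<bar>x $ j - \<eta> * m\<bar> < \<tau>'" using assms(1,2) by linarith
    then show "j \<in> {i. near_grid \<eta> \<tau>' x i}" unfolding near_grid_def by blast
  qed
  \<comment> \<open>At least \<open>k\<close> coordinates are close at scale \<tau> and at most
    \<open>k\<close> at the larger scale, so both sets coincide and have exactly \<open>k\<close>
    elements.\<close>
  have "card {i. near_grid \<eta> \<tau>' x i} \<le> card I" and kI: "k \<le> card I"
    using x unfolding grid_level_def I_def by auto
  then have I': "{i. near_grid \<eta> \<tau>' x i} = I"
    using card_seteq[OF _ sub] by simp
  then have cardI: "card I = k"
    using x kI unfolding grid_level_def by simp
  then obtain i where i: "i \<in> I" using assms(4) by fastforce
  then obtain m :: int where m: "\<bar>x $ i - \<eta> * m\<bar> < \<tau>"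
    unfolding I_def near_grid_def by blast
  define r where "r = \<tau>' / 4"
  have r: "2 * \<tau> \<le> r" "4 * r \<le> \<eta>" "\<tau>' = 4 * r" "0 < r" using assms by (auto simp: r_def)
  define y where "y = x + axis i r"
  have "norm (axis i r :: real ^ 'd) \<le> r"
    using norm_le_l1_cart[of "axis i r :: real ^ 'd"] r(4)
    by (simp add: axis_def if_distrib cong: if_cong)
  then have "y \<in> cball x r" by (simp add: y_def dist_norm)
  moreover have "z \<notin> grid_level \<eta> \<tau> k" if z: "z \<in> cball y (r - 2 * \<tau>)" for z
  proof -
    have zy: "\<bar>y $ j - z $ j\<bar> \<le> r - 2 * \<tau>" for j
      using z dist_vec_nth_le[of y j z] by (simp add: dist_real_def)
    have "{j. near_grid \<eta> \<tau> z j} \<subseteq> I - {i}"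
    proof safe
      fix j assume "near_grid \<eta> \<tau> z j"
      then obtain l :: int where l: "\<bar>z $ j - \<eta> * l\<bar> < \<tau>" unfolding near_grid_def by blast
      show "j \<in> I"
      proof (rule ccontr)
        assume j: "j \<notin> I"
        with i have "y $ j = x $ j" by (auto simp: y_def axis_def)
        with l zy[of j] have "\<bar>x $ j - \<eta> * l\<bar> < \<tau>'" using r assms(1) by linarith
        with j I' show False unfolding near_grid_def by auto
      qed
    next
      assume "near_grid \<eta> \<tau> z i"
      then obtain l :: int where l: "\<bar>z $ i - \<eta> * l\<bar> < \<tau>" unfolding near_grid_def by blast
      have y: "y $ i = x $ i + r" by (simp add: y_def axis_def)
      \<comment> \<open>The coordinate \<open>z $ i\<close> lies above \<eta>m + \<tau> and below
        \<eta>m + 2r - \<tau>, with 2r at most \<eta>/2. This excludes all grid values up to index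
        \<open>m\<close> and all from index \<open>m + 1\<close> on.\<close>
      have "\<eta> * of_int l \<le> \<eta> * of_int m \<or> \<eta> * of_int m + \<eta> \<le> \<eta> * of_int l"
      proof (cases "l \<le> m")
        case True
        then show ?thesis using r by (intro disjI1 mult_left_mono) auto
      next
        case False
        then have "m + 1 \<le> l" by simp
        then have "\<eta> * of_int (m + 1) \<le> \<eta> * of_int l"
          using r by (intro mult_left_mono) (simp_all only: of_int_le_iff)
        then show ?thesis by (simp add: distrib_left)
      qed
      then show False
        using l zy[of i] y m r assms(1) by (elim disjE) linarith+
    qed
    then have "card {j. near_grid \<eta> \<tau> z j} \<le> card (I - {i})"
      by (intro card_mono) auto
    also have "\<dots> < k" using cardI i assms(4) by simp
    finally show ?thesis by (simp add: grid_level_def)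
  qed
  ultimately show ?thesis unfolding r_def by blast
qed

text \<open>Whenever \<open>x\<close> is outside level \<open>k + 1\<close>, the level
  \<open>k\<close> has a hole near \<open>x\<close>, and for \<open>n\<close> at least
  \<open>m\<close> this hole misses all of \<open>E\<close>. Its relative size tends to 1 along
  these \<open>n\<close>, since the ratio of consecutive widths is \<eta>^n.\<close>

lemma strongly_porous_grid_levels:
  fixes \<eta> :: "nat \<Rightarrow> real" and w :: "nat \<Rightarrow> nat \<Rightarrow> real"
  assumes \<eta>: "\<And>n. 0 < \<eta> n" "\<And>n. \<eta> n \<le> (1/2) ^ n"
    and w: "\<And>n k. w n k = \<eta> n ^ (1 + n * (CARD('d) + 1 - k))"
    and k: "0 < k" "k \<le> CARD('d)"
    and E: "\<And>x n. x \<in> E \<Longrightarrow> m \<le> n \<Longrightarrow> x \<in> grid_level (\<eta> n) (w n k) k"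
      "\<And>x. x \<in> E \<Longrightarrow> \<exists>\<^sub>F n in sequentially. x \<notin> grid_level (\<eta> n) (w n (Suc k)) (Suc k)"
  shows "strongly_porous (E :: (real ^ 'd) set)"
proof (rule strongly_porousI)
  fix x \<epsilon> assume x: "x \<in> E" and \<epsilon>: "(0::real) < \<epsilon>"
  have "(\<lambda>n. (1/2::real) ^ n) \<longlonglongrightarrow> 0" by (rule LIMSEQ_power_zero) simp
  then have "\<forall>\<^sub>F n in sequentially. (1/2::real) ^ n < min 1 \<epsilon> / 8"
    using \<epsilon> by (intro order_tendstoD) auto
  \<comment> \<open>The bound 1 is for \<open>\<eta> n ^ n \<le> \<eta> n\<close>, the bound
    \<open>m\<close> for the inclusion of \<open>E\<close> in level \<open>k\<close>.\<close>
  moreover have "\<forall>\<^sub>F n in sequentially. max 1 m \<le> n" by (rule eventually_ge_at_top)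
  ultimately have "\<forall>\<^sub>F n in sequentially. (1/2::real) ^ n < min 1 \<epsilon> / 8 \<and> max 1 m \<le> n"
    by (rule eventually_conj)
  with E(2)[OF x] have "\<exists>\<^sub>F n in sequentially. x \<notin> grid_level (\<eta> n) (w n (Suc k)) (Suc k) \<and>
      (1/2::real) ^ n < min 1 \<epsilon> / 8 \<and> max 1 m \<le> n"
    by (rule frequently_eventually_frequently)
  then obtain n where n: "x \<notin> grid_level (\<eta> n) (w n (Suc k)) (Suc k)"
      "(1/2::real) ^ n < min 1 \<epsilon> / 8" "1 \<le> n" "m \<le> n"
    using frequently_ex by fastforce
  have \<eta>n: "0 < \<eta> n" "8 * \<eta> n < 1" "8 * \<eta> n < \<epsilon>" using \<eta>[of n] n(2) by auto
  have pow: "\<eta> n ^ n \<le> \<eta> n" using power_decreasing[of 1 n "\<eta> n"] n(3) \<eta>n by simp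
  define \<tau> \<tau>' where "\<tau> = w n k" and "\<tau>' = w n (Suc k)"
  \<comment> \<open>Consecutive exponents differ by \<open>n\<close>. For
    \<open>k = CARD('d)\<close> the wider width is \<eta> itself.\<close>
  have "1 + n * (CARD('d) + 1 - k) = n + (1 + n * (CARD('d) + 1 - Suc k))"
    using k by (simp add: Suc_diff_le)
  then have \<tau>: "\<tau> = \<eta> n ^ n * \<tau>'" unfolding \<tau>_def \<tau>'_def w by (simp only: power_add)
  have \<tau>': "0 < \<tau>'" "\<tau>' \<le> \<eta> n"
    using \<eta>n power_decreasing[of 1 "1 + n * (CARD('d) + 1 - Suc k)" "\<eta> n"]
    by (auto simp: \<tau>'_def w)
  \<comment> \<open>The first bound makes the loss 2\<tau> at most \<epsilon> times the radius
    \<tau>'/4; the second is what the existence of the hole requires.\<close>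
  have \<tau>8: "8 * \<tau> \<le> \<epsilon> * \<tau>'" "8 * \<tau> \<le> 1 * \<tau>'"
    unfolding \<tau> using pow \<eta>n \<tau>' by (simp_all only: mult.assoc[symmetric]) (intro mult_right_mono; linarith)+
  obtain y where "y \<in> cball x (\<tau>' / 4)" "cball y (\<tau>' / 4 - 2 * \<tau>) \<inter> grid_level (\<eta> n) \<tau> k = {}"
    using grid_level_hole[of \<tau> \<tau>' "\<eta> n" k x] \<tau> \<tau>8 \<tau>' \<eta>n k n(1) E(1)[OF x n(4)]
    unfolding \<tau>_def[symmetric] \<tau>'_def[symmetric] by auto
  moreover have "E \<subseteq> grid_level (\<eta> n) \<tau> k" using E(1) n(4) unfolding \<tau>_def by blast
  moreover have "(1 - \<epsilon>) * (\<tau>' / 4) \<le> \<tau>' / 4 - 2 * \<tau>" using \<tau>8(1)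
    by (simp add: left_diff_distrib)
  moreover have "0 < \<tau>' / 4" "\<tau>' / 4 < \<epsilon>" using \<tau>' \<eta>n by linarith+
  ultimately show "\<exists>r s y. 0 < r \<and> r < \<epsilon> \<and> y \<in> cball x r \<and> (1 - \<epsilon>) * r \<le> s \<and> cball y s \<inter> E = {}"
    by blast
qed

lemma sigma_strongly_porous_grid_levels:
  fixes \<eta> :: "nat \<Rightarrow> real"
  assumes \<eta>: "\<And>n. 0 < \<eta> n" "\<And>n. \<eta> n \<le> (1/2) ^ n"
    and A: "\<And>x. x \<in> A \<Longrightarrow>
      \<forall>\<^sub>F n in sequentially. x \<in> grid_level (\<eta> n) (\<eta> n ^ (1 + n * CARD('d))) (Suc 0)"
  shows "sigma_strongly_porous (A :: (real ^ 'd) set)"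
proof -
  txt \<open>Decompose \<open>A\<close> by the largest \<open>k\<close> such that the point eventually lies in level \<open>k\<close>.\<close>
  define L :: "nat \<Rightarrow> nat \<Rightarrow> (real ^ 'd) set"
    where "L n k = grid_level (\<eta> n) (\<eta> n ^ (1 + n * (CARD('d) + 1 - k))) k" for n k
  \<comment> \<open>The index \<open>m\<close> marks the start of permanent membership in level
    \<open>k\<close>; with finitely many \<open>k\<close> the pieces are countably many.\<close>
  define E where "E = (\<lambda>(m, k). {x \<in> A. (\<forall>n\<ge>m. x \<in> L n k) \<and> (\<exists>\<^sub>F n in sequentially. x \<notin> L n (Suc k))})"
  have "strongly_porous (E (m, k))" if "k \<in> {1..CARD('d)}" for m k
    using strongly_porous_grid_levels[OF \<eta> refl, where k = k and m = m and E = "E (m, k)"] that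
    by (auto simp: E_def L_def)
  moreover have "A = \<Union>(E ` (UNIV \<times> {1..CARD('d)}))"
  proof
    show "\<Union>(E ` (UNIV \<times> {1..CARD('d)})) \<subseteq> A" by (auto simp: E_def)
    show "A \<subseteq> \<Union>(E ` (UNIV \<times> {1..CARD('d)}))"
    proof
      fix x assume x: "x \<in> A"
      define Q where "Q k \<longleftrightarrow> 1 \<le> k \<and> (\<forall>\<^sub>F n in sequentially. x \<in> L n k)" for k
      \<comment> \<open>For \<open>k = 1\<close> the exponent is exactly the one in the
        hypothesis.\<close>
      have Q1: "Q 1" using A[OF x] by (simp add: Q_def L_def)
      have bnd: "k \<le> CARD('d)" if "Q k" for k
      proof -
        obtain n where "x \<in> L n k" using \<open>Q k\<close> unfolding Q_def eventually_sequentially by blast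
        then have "k \<le> card {i. near_grid (\<eta> n) (\<eta> n ^ (1 + n * (CARD('d) + 1 - k))) x i}"
          by (simp add: L_def grid_level_def)
        also have "\<dots> \<le> CARD('d)" by (rule card_mono) auto
        finally show ?thesis .
      qed
      define k where "k = Greatest Q"
      have Qk: "Q k" unfolding k_def using GreatestI_nat[of Q, OF Q1] bnd by blast
      have "\<not> Q (Suc k)"
        using Greatest_le_nat[of Q "Suc k" "CARD('d)"] bnd unfolding k_def by auto
      then have "\<exists>\<^sub>F n in sequentially. x \<notin> L n (Suc k)" by (simp add: Q_def frequently_def)
      moreover obtain m where "\<forall>n\<ge>m. x \<in> L n k" using Qk unfolding Q_def eventually_sequentially by blast
      ultimately have "x \<in> E (m, k)" using x by (simp add: E_def)
      moreover have "k \<in> {1..CARD('d)}" using Qk bnd by (auto simp: Q_def)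
      ultimately show "x \<in> \<Union>(E ` (UNIV \<times> {1..CARD('d)}))" by blast
    qed
  qed
  ultimately show ?thesis
    unfolding sigma_strongly_porous_def
    by (intro exI[of _ "E ` (UNIV \<times> {1..CARD('d)})"]) auto
qed

section \<open>Lower packing dimension of limits of grid neighbourhoods\<close>

text \<open>Some coordinate is close to the grid: there are \<open>CARD('d)\<close> choices for it
  and order 1/\<eta> for its grid value. Each remaining coordinate is located in one of order
  1/\<tau> intervals of length \<tau>.\<close>

lemma covering_number_grid_level_le:
  fixes E :: "(real ^ 'd) set"
  assumes "0 < \<tau>" "\<tau> \<le> 1" "0 < \<eta>" "\<eta> \<le> 1" "0 \<le> R"
    and E: "E \<subseteq> cball 0 R" "E \<subseteq> grid_level \<eta> \<tau> (Suc 0)"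
  shows "covering_number (2 * real CARD('d) * \<tau>) E
    \<le> ennreal (real CARD('d) * ((2 * R + 3) / \<eta>) * ((2 * R + 3) / \<tau>) ^ (CARD('d) - 1))"
proof -
  \<comment> \<open>\<open>N \<sigma>\<close> bounds the integers \<open>l\<close> with
    \<open>\<bar>\<sigma> * l\<bar> \<le> R + 1\<close>; the extra 1 absorbs the rounding error
    \<tau>.\<close>
  define N where "N \<sigma> = \<lfloor>(R + 1) / \<sigma>\<rfloor>" for \<sigma> :: real
  have N: "real (nat (2 * N \<sigma> + 1)) \<le> (2 * R + 3) / \<sigma>" if "0 < \<sigma>" "\<sigma> \<le> 1" for \<sigma>
  proof -
    have "0 \<le> N \<sigma>" unfolding N_def using that assms(5) by simp
    moreover have "real_of_int (N \<sigma>) \<le> (R + 1) / \<sigma>" unfolding N_def by simp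
    moreover have "1 \<le> 1 / \<sigma>" using that by simp
    ultimately show ?thesis by (simp add: add_divide_distrib)
  qed
  define S where "S i = (\<Pi>\<^sub>E j\<in>(UNIV::'d set). if j = i then {- N \<eta>..N \<eta>} else {- N \<tau>..N \<tau>})" for i
  \<comment> \<open>\<open>w i\<close> numbers the nearby grid hyperplane, the other
    \<open>w j\<close> number the intervals of length \<tau>.\<close>
  define cell :: "'d \<times> ('d \<Rightarrow> int) \<Rightarrow> (real ^ 'd) set"
    where "cell = (\<lambda>(i, w). {x. \<bar>x $ i - \<eta> * of_int (w i)\<bar> < \<tau> \<and> (\<forall>j. j \<noteq> i \<longrightarrow> \<lfloor>x $ j / \<tau>\<rfloor> = w j)})"
  define \<C> where "\<C> = cell ` (SIGMA i:UNIV. S i)"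
  have finS: "finite (S i)" for i unfolding S_def by (intro finite_PiE) auto
  have fin: "finite (SIGMA i:UNIV. S i)" by (intro finite_SigmaI finS) auto
  have cardS: "real (card (S i)) \<le> (2 * R + 3) / \<eta> * ((2 * R + 3) / \<tau>) ^ (CARD('d) - 1)" for i
  proof -
    have "card (S i) = (\<Prod>j\<in>UNIV. nat (2 * N (if j = i then \<eta> else \<tau>) + 1))"
      unfolding S_def by (subst card_PiE) (auto intro!: prod.cong simp: algebra_simps)
    also have "\<dots> = nat (2 * N \<eta> + 1) * (\<Prod>j\<in>UNIV - {i}. nat (2 * N \<tau> + 1))"
      by (subst prod.remove[of _ i]) (auto intro!: prod.cong)
    also have "\<dots> = nat (2 * N \<eta> + 1) * nat (2 * N \<tau> + 1) ^ (CARD('d) - 1)"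
      by (simp add: card_Diff_singleton)
    finally have "real (card (S i)) = real (nat (2 * N \<eta> + 1)) * real (nat (2 * N \<tau> + 1)) ^ (CARD('d) - 1)"
      by (simp only: of_nat_mult of_nat_power)
    also have "\<dots> \<le> (2 * R + 3) / \<eta> * ((2 * R + 3) / \<tau>) ^ (CARD('d) - 1)"
      using N[of \<eta>] N[of \<tau>] assms by (intro mult_mono power_mono) auto
    finally show ?thesis .
  qed
  have "real (card \<C>) \<le> real (card (SIGMA i:UNIV. S i))"
    unfolding \<C>_def using card_image_le[OF fin] by simp
  also have "\<dots> = (\<Sum>i\<in>UNIV. real (card (S i)))"
    using finS by (simp add: card_SigmaI)
  also have "\<dots> \<le> (\<Sum>i\<in>(UNIV::'d set). (2 * R + 3) / \<eta> * ((2 * R + 3) / \<tau>) ^ (CARD('d) - 1))"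
    by (intro sum_mono cardS)
  finally have card: "real (card \<C>) \<le> real CARD('d) * ((2 * R + 3) / \<eta>) * ((2 * R + 3) / \<tau>) ^ (CARD('d) - 1)"
    by simp
  have dist: "norm (x - y) \<le> 2 * real CARD('d) * \<tau>" if xy: "x \<in> cell (i, w)" "y \<in> cell (i, w)" for x y i w
  proof -
    have "\<bar>(x - y) $ j\<bar> \<le> 2 * \<tau>" for j
    proof (cases "j = i")
      case True
      then show ?thesis using xy by (auto simp: cell_def)
    next
      case False
      then have "\<lfloor>x $ j / \<tau>\<rfloor> = \<lfloor>y $ j / \<tau>\<rfloor>" using xy by (simp add: cell_def)
      then have "\<bar>x $ j / \<tau> - y $ j / \<tau>\<bar> \<le> 1" by linarith
      then have "\<bar>x $ j - y $ j\<bar> / \<tau> \<le> 1" using assms(1) by (simp add: diff_divide_distrib[symmetric])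
      then have "\<bar>x $ j - y $ j\<bar> \<le> \<tau>" using assms(1) by (simp add: field_simps)
      then show ?thesis using assms(1) by simp
    qed
    then have "(\<Sum>j\<in>UNIV. \<bar>(x - y) $ j\<bar>) \<le> (\<Sum>j\<in>(UNIV::'d set). 2 * \<tau>)" by (intro sum_mono)
    then show ?thesis using norm_le_l1_cart[of "x - y"] by (simp add: mult_ac)
  qed
  have cover: "E \<subseteq> \<Union>\<C>"
  proof
    fix x assume x: "x \<in> E"
    then obtain i k where k: "\<bar>x $ i - \<eta> * of_int k\<bar> < \<tau>"
      using E(2) mem_grid_level_1 unfolding near_grid_def by blast
    have xR: "\<bar>x $ j\<bar> \<le> R" for j
      using x E(1) component_le_norm_cart[of x j] by (force simp: dist_norm)
    have bd: "l \<in> {- N \<sigma>..N \<sigma>}" if "\<bar>\<sigma> * of_int l\<bar> \<le> R + 1" "0 < \<sigma>" for l :: int and \<sigma>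
    proof -
      have "real_of_int \<bar>l\<bar> \<le> (R + 1) / \<sigma>" using that by (simp add: abs_mult field_simps)
      then have "\<bar>l\<bar> \<le> N \<sigma>" unfolding N_def by (simp only: le_floor_iff)
      then show ?thesis by auto
    qed
    define w where "w j = (if j = i then k else \<lfloor>x $ j / \<tau>\<rfloor>)" for j
    have "w \<in> S i"
    proof -
      have "k \<in> {- N \<eta>..N \<eta>}" using k xR[of i] assms by (intro bd) auto
      moreover have "\<lfloor>x $ j / \<tau>\<rfloor> \<in> {- N \<tau>..N \<tau>}" for j
      proof (rule bd)
        have "\<bar>x $ j / \<tau> - of_int \<lfloor>x $ j / \<tau>\<rfloor>\<bar> \<le> 1" by linarith
        then have "\<tau> * \<bar>x $ j / \<tau> - of_int \<lfloor>x $ j / \<tau>\<rfloor>\<bar> \<le> \<tau> * 1"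
          using assms(1) by (intro mult_left_mono) auto
        also have "\<tau> * \<bar>x $ j / \<tau> - of_int \<lfloor>x $ j / \<tau>\<rfloor>\<bar> = \<bar>\<tau> * (x $ j / \<tau> - of_int \<lfloor>x $ j / \<tau>\<rfloor>)\<bar>"
          using assms(1) by (simp add: abs_mult)
        also have "\<tau> * (x $ j / \<tau> - of_int \<lfloor>x $ j / \<tau>\<rfloor>) = x $ j - \<tau> * of_int \<lfloor>x $ j / \<tau>\<rfloor>"
          using assms(1) by (simp add: right_diff_distrib)
        finally show "\<bar>\<tau> * of_int \<lfloor>x $ j / \<tau>\<rfloor>\<bar> \<le> R + 1"
          using xR[of j] assms(2) by linarith
      qed (use assms in auto)
      ultimately show ?thesis unfolding S_def w_def by (auto simp: PiE_def)
    qed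
    moreover have "x \<in> cell (i, w)" using k by (simp add: cell_def w_def)
    ultimately show "x \<in> \<Union>\<C>" unfolding \<C>_def by blast
  qed
  have "bounded C \<and> diameter C \<le> 2 * real CARD('d) * \<tau>" if C: "C \<in> \<C>" for C
  proof -
    obtain i w where iw: "C = cell (i, w)" using C unfolding \<C>_def by auto
    have "bounded C"
    proof (cases "C = {}")
      case False
      then obtain y where "y \<in> C" by blast
      then show ?thesis using dist iw unfolding bounded_def dist_norm by blast
    qed simp
    moreover have "diameter C \<le> 2 * real CARD('d) * \<tau>"
      using assms(1) dist iw by (intro diameter_le) auto
    ultimately show ?thesis by blast
  qed
  with cover have "covering_number (2 * real CARD('d) * \<tau>) E \<le> of_nat (card \<C>)"
    unfolding covering_number_def by (intro INF_lower) (auto simp: \<C>_def intro: fin)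
  also have "\<dots> \<le> ennreal (real CARD('d) * ((2 * R + 3) / \<eta>) * ((2 * R + 3) / \<tau>) ^ (CARD('d) - 1))"
    using card by (simp add: ennreal_of_nat_eq_real_of_nat ennreal_leI)
  finally show ?thesis .
qed

text \<open>A lower limit needs control along one sequence of scales only.\<close>

lemma Liminf_at_right_eq_0:
  fixes h :: "real \<Rightarrow> ennreal"
  assumes "\<delta> \<longlonglongrightarrow> 0" "\<And>n. 0 < \<delta> n" "b \<longlonglongrightarrow> 0" "\<forall>\<^sub>F n in sequentially. h (\<delta> n) \<le> ennreal (b n)"
  shows "Liminf (at_right 0) h = 0"
proof -
  have "Liminf (at_right 0) h \<le> 0"
  proof (rule Liminf_least)
    fix P assume P: "\<forall>\<^sub>F r in at_right 0. P (r::real)"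
    have "filterlim \<delta> (at_right 0) sequentially"
      using assms(1,2) by (auto simp: filterlim_at less_imp_neq[symmetric] intro!: always_eventually)
    then have "\<forall>\<^sub>F n in sequentially. P (\<delta> n)" using P filterlim_iff by blast
    then have "\<forall>\<^sub>F n in sequentially. (INF x\<in>Collect P. h x) \<le> ennreal (b n)"
      using assms(4) by eventually_elim (auto intro: INF_lower2)
    moreover have "(\<lambda>n. ennreal (b n)) \<longlonglongrightarrow> 0"
      using tendsto_ennrealI[OF assms(3)] by simp
    ultimately show "(INF x\<in>Collect P. h x) \<le> 0"
      using tendsto_lowerbound[of "\<lambda>n. ennreal (b n)" 0 sequentially] by simp
  qed
  then show ?thesis by simp
qed

text \<open>At scale of order \<tau> = \<eta>^(1 + n d) the covering bound times the power of the
  scale is a constant times \<tau>^a / \<eta> with a = s - (d - 1) > 0. The exponent 1 + n d grows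
  with \<open>n\<close>, so eventually \<tau>^a is at most \<eta>^2, however small a is.\<close>

lemma lower_box_premeasure_grid_levels:
  fixes \<eta> :: "nat \<Rightarrow> real"
  assumes \<eta>: "\<And>n. 0 < \<eta> n" "\<And>n. \<eta> n \<le> (1/2) ^ n"
    and E: "(E :: (real ^ 'd) set) \<subseteq> cball 0 R" "0 \<le> R"
      "\<And>n. m \<le> n \<Longrightarrow> E \<subseteq> grid_level (\<eta> n) (\<eta> n ^ (1 + n * CARD('d))) (Suc 0)"
    and s: "real CARD('d) - 1 < s"
  shows "lower_box_premeasure s E = 0"
proof -
  define D where "D = real CARD('d)"
  have D: "1 \<le> D" by (simp add: D_def Suc_le_eq)
  define a where "a = s - (D - 1)"
  have a: "0 < a" using s by (simp add: a_def D_def)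
  define \<tau> where "\<tau> n = \<eta> n ^ (1 + n * CARD('d))" for n
  define c where "c = 2 * R + 3"
  define K where "K = D * c * c ^ (CARD('d) - 1) * (2 * D) powr s"
  have K: "0 \<le> K" using E(2) D by (simp add: K_def c_def)
  have \<eta>1: "\<eta> n \<le> 1" for n using \<eta>(2)[of n] power_le_one[of "1/2::real" n] by linarith
  have \<tau>: "0 < \<tau> n" "\<tau> n \<le> \<eta> n" for n
    using \<eta>(1)[of n] \<eta>1[of n] power_decreasing[of 1 "1 + n * CARD('d)" "\<eta> n"] by (auto simp: \<tau>_def)
  have lim2: "(\<lambda>n. (1/2::real) ^ n) \<longlonglongrightarrow> 0" by (rule LIMSEQ_power_zero) simp
  show ?thesis
    unfolding lower_box_premeasure_def
  proof (rule Liminf_at_right_eq_0)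
    have "\<tau> \<longlonglongrightarrow> 0"
      by (rule real_tendsto_sandwich[OF _ _ tendsto_const lim2])
        (use \<tau> \<eta>(2) in \<open>auto intro!: always_eventually less_imp_le order_trans[OF \<tau>(2) \<eta>(2)]\<close>)
    then show "(\<lambda>n. 2 * D * \<tau> n) \<longlonglongrightarrow> 0" by (rule tendsto_mult_right_zero)
    show "0 < 2 * D * \<tau> n" for n using D \<tau>(1)[of n] by simp
    show "(\<lambda>n. K * (1/2) ^ n) \<longlonglongrightarrow> 0" using lim2 by (rule tendsto_mult_right_zero)
    \<comment> \<open>From \<open>2 / a\<close> on, the exponent of \<eta> in \<tau>^a is at least
      2.\<close>
    have "\<forall>\<^sub>F n in sequentially. max m (nat \<lceil>2 / a\<rceil>) \<le> n" by (rule eventually_ge_at_top)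
    then show "\<forall>\<^sub>F n in sequentially.
        covering_number (2 * D * \<tau> n) E * ennreal ((2 * D * \<tau> n) powr s) \<le> ennreal (K * (1/2) ^ n)"
    proof eventually_elim
      case (elim n)
      have "covering_number (2 * D * \<tau> n) E \<le> ennreal (D * (c / \<eta> n) * (c / \<tau> n) ^ (CARD('d) - 1))"
        unfolding D_def c_def
        using elim \<tau>[of n] \<eta>(1)[of n] \<eta>1[of n] E(1,2) E(3)[of n, folded \<tau>_def]
        by (intro covering_number_grid_level_le) auto
      then have "covering_number (2 * D * \<tau> n) E * ennreal ((2 * D * \<tau> n) powr s)
          \<le> ennreal (D * (c / \<eta> n) * (c / \<tau> n) ^ (CARD('d) - 1)) * ennreal ((2 * D * \<tau> n) powr s)"
        by (intro mult_right_mono) auto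
      also have "\<dots> = ennreal (D * (c / \<eta> n) * (c / \<tau> n) ^ (CARD('d) - 1) * (2 * D * \<tau> n) powr s)"
        using D E(2) \<tau>(1)[of n] \<eta>(1)[of n] by (intro ennreal_mult[symmetric]) (auto simp: c_def)
      also have "D * (c / \<eta> n) * (c / \<tau> n) ^ (CARD('d) - 1) * (2 * D * \<tau> n) powr s
          = K * (\<tau> n powr a / \<eta> n)"
      proof -
        have "\<tau> n powr a = \<tau> n powr s / \<tau> n powr (real (CARD('d) - 1))"
          unfolding powr_diff[symmetric] a_def D_def by (simp add: of_nat_diff Suc_le_eq)
        also have "\<tau> n powr (real (CARD('d) - 1)) = \<tau> n ^ (CARD('d) - 1)"
          using \<tau>(1) by (rule powr_realpow)
        finally have "\<tau> n powr a = \<tau> n powr s / \<tau> n ^ (CARD('d) - 1)" .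
        then show ?thesis
          using D \<tau>(1)[of n] by (simp add: K_def power_divide powr_mult mult_ac)
      qed
      also have "\<tau> n powr a / \<eta> n \<le> \<eta> n"
      proof -
        have "2 / a \<le> real n" using elim by linarith
        then have "2 \<le> real n * a" using a by (simp add: field_simps)
        also have "\<dots> \<le> real (1 + n * CARD('d)) * a"
        proof (intro mult_right_mono)
          have "n * 1 \<le> n * CARD('d)" by (intro mult_left_mono) (auto simp: Suc_le_eq)
          then show "real n \<le> real (1 + n * CARD('d))" by linarith
        qed (use a in auto)
        finally have "\<eta> n powr (real (1 + n * CARD('d)) * a) \<le> \<eta> n powr 2"
          using \<eta>(1)[of n] \<eta>1[of n] by (intro powr_mono') auto
        moreover have "\<tau> n powr a = \<eta> n powr (real (1 + n * CARD('d)) * a)"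
          unfolding \<tau>_def by (simp only: powr_realpow[OF \<eta>(1), symmetric] powr_powr)
        ultimately have "\<tau> n powr a \<le> \<eta> n * \<eta> n"
          using \<eta>(1)[of n] by (simp add: powr_numeral power2_eq_square)
        then show ?thesis using \<eta>(1)[of n] by (simp add: field_simps)
      qed
      then have "ennreal (K * (\<tau> n powr a / \<eta> n)) \<le> ennreal (K * (1/2) ^ n)"
        using K \<eta>(2)[of n] by (intro ennreal_leI mult_left_mono) auto
      finally show ?case .
    qed
  qed
qed

lemma lower_packing_dim_grid_levels:
  fixes \<eta> :: "nat \<Rightarrow> real"
  assumes \<eta>: "\<And>n. 0 < \<eta> n" "\<And>n. \<eta> n \<le> (1/2) ^ n"
    and A: "\<And>x. x \<in> A \<Longrightarrow>
      \<forall>\<^sub>F n in sequentially. x \<in> grid_level (\<eta> n) (\<eta> n ^ (1 + n * CARD('d))) (Suc 0)"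
  shows "lower_packing_dim (A :: (real ^ 'd) set) \<le> ereal (real CARD('d) - 1)"
proof -
  \<comment> \<open>One index serves as radius and as starting stage, since both conditions weaken
    as \<open>m\<close> grows.\<close>
  define F where "F m = {x \<in> cball 0 (real m). \<forall>n\<ge>m. 
      (x :: real ^ 'd) \<in> grid_level (\<eta> n) (\<eta> n ^ (1 + n * CARD('d))) (Suc 0)}" for m :: nat
  have cover: "A \<subseteq> (\<Union>m. F m)"
  proof
    fix x assume "x \<in> A"
    then obtain m1 where m1: "\<forall>n\<ge>m1. x \<in> grid_level (\<eta> n) (\<eta> n ^ (1 + n * CARD('d))) (Suc 0)"
      using A unfolding eventually_sequentially by blast
    obtain m2 where "norm x \<le> real m2" using real_arch_simple by blast
    with m1 have "x \<in> F (max m1 m2)" by (auto simp: F_def)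
    then show "x \<in> (\<Union>m. F m)" by blast
  qed
  have zero: "lower_packing_measure s A = 0" if "real CARD('d) - 1 < s" for s
  proof -
    have "lower_box_premeasure s (F m) = 0" for m
      by (rule lower_box_premeasure_grid_levels[OF \<eta>, of _ "real m" m]) (use that in \<open>auto simp: F_def\<close>)
    then have "(\<Sum>m. lower_box_premeasure s (F m)) = 0" by simp
    moreover have "lower_packing_measure s A \<le> (\<Sum>m. lower_box_premeasure s (F m))"
      unfolding lower_packing_measure_def using cover by (intro INF_lower) auto
    ultimately show ?thesis by simp
  qed
  have "s \<le> real CARD('d) - 1" if "0 < lower_packing_measure s A" for s
    using zero[of s] that by (cases "real CARD('d) - 1 < s") auto
  then show ?thesis
    unfolding lower_packing_dim_def by (intro Sup_least) (auto simp: Suc_le_eq)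
qed

section \<open>Hausdorff dimension of limsup sets\<close>

text \<open>A Borel-Cantelli argument: the balls of all stages from \<open>m\<close> on cover the
  set. Once \<open>m\<close> is at least 1/s, the exponents 1/(n + 1) are below s, so the assumed
  sums control the s-sums, whose tails tend to 0.\<close>

lemma hausdorff_dim_limsup_balls:
  fixes V :: "nat \<Rightarrow> 'a::euclidean_space set"
  assumes V: "\<And>n. finite (V n)" "\<And>n. 0 < \<rho> n" "\<And>n. \<rho> n \<le> (1/2) ^ n"
    "\<And>n. real (card (V n)) * \<rho> n powr (1 / real (Suc n)) \<le> (1/4) ^ n"
  shows "hausdorff_dim {y. \<exists>\<^sub>F n in sequentially. y \<in> (\<Union>v\<in>V n. ball v (\<rho> n))} = 0"
proof -
  define B where "B = {y. \<exists>\<^sub>F n in sequentially. y \<in> (\<Union>v\<in>V n. ball v (\<rho> n))}"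
  have lim2: "(\<lambda>n. (1/2::real) ^ n) \<longlonglongrightarrow> 0" by (rule LIMSEQ_power_zero) simp
  have pre: "hausdorff_premeasure s \<delta> B = 0" if s: "0 < s" and \<delta>: "0 < \<delta>" for s \<delta>
  proof -
    have "\<forall>\<^sub>F m in sequentially. (1/2::real) ^ m < \<delta> / 2"
      using lim2 \<delta> by (intro order_tendstoD) auto
    moreover have "\<forall>\<^sub>F m in sequentially. nat \<lceil>1 / s\<rceil> \<le> m" by (rule eventually_ge_at_top)
    ultimately have "\<forall>\<^sub>F m in sequentially.
        hausdorff_premeasure s \<delta> B \<le> ennreal (2 powr s * 2 * (1/2) ^ m)"
    proof eventually_elim
      case (elim m)
      obtain e where e: "\<And>n. bij_betw (e n) {..<card (V n)} (V n)"
        using ex_bij_betw_nat_finite[OF V(1)] unfolding atLeast0LessThan by metis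
      \<comment> \<open>The array of balls is padded with empty sets, which have diameter 0 and
        contribute nothing, and is enumerated by \<open>prod_decode\<close>.\<close>
      define U where "U = (\<lambda>(n, i). if m \<le> n \<and> i < card (V n) then ball (e n i) (\<rho> n) else {})"
      have U: "bounded (U p) \<and> diameter (U p) \<le> \<delta>" for p
      proof -
        obtain n i where p: "p = (n, i)" by fastforce
        have "2 * \<rho> n \<le> \<delta>" if "m \<le> n"
        proof -
          have "(1/2::real) ^ n \<le> (1/2) ^ m" using that by (intro power_decreasing) auto
          then show ?thesis using V(3)[of n] elim(1) by linarith
        qed
        then show ?thesis using V(2)[of n] \<delta> by (auto simp: U_def p)
      qed
      have "B \<subseteq> (\<Union>k. U (prod_decode k))"
      proof
        fix y assume "y \<in> B"
        then obtain n v where nv: "m \<le> n" "v \<in> V n" "y \<in> ball v (\<rho> n)"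
          unfolding B_def frequently_sequentially by blast
        then obtain i where "i < card (V n)" "v = e n i"
          using e[of n] unfolding bij_betw_def by blast
        then have "y \<in> U (n, i)" using nv by (simp add: U_def)
        then have "y \<in> U (prod_decode (prod_encode (n, i)))" by simp
        then show "y \<in> (\<Union>k. U (prod_decode k))" by blast
      qed
      then have "hausdorff_premeasure s \<delta> B \<le> (\<Sum>k. ennreal (diameter (U (prod_decode k)) powr s))"
        unfolding hausdorff_premeasure_def using U by (intro INF_lower) auto
      also have "\<dots> = (\<Sum>n. \<Sum>i. ennreal (diameter (U (n, i)) powr s))"
        by (rule suminf_ennreal_2dimen) simp
      also have "\<dots> \<le> (\<Sum>n. ennreal (2 powr s * (1/2) ^ m * (1/2) ^ n))"
      proof (intro suminf_le allI summableI)
        fix n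
        have "(\<Sum>i. ennreal (diameter (U (n, i)) powr s))
            = (\<Sum>i<card (V n). ennreal (diameter (U (n, i)) powr s))"
          by (intro suminf_finite) (auto simp: U_def)
        also have "\<dots> \<le> ennreal (2 powr s * (1/2) ^ m * (1/2) ^ n)"
        proof (cases "m \<le> n")
          case True
          have \<rho>1: "\<rho> n \<le> 1" using V(3)[of n] power_le_one[of "1/2::real" n] by linarith
          have "1 / s \<le> real (Suc n)" using elim(2) True by linarith
          then have "1 / real (Suc n) \<le> s" using s by (simp add: field_simps)
          then have "\<rho> n powr s \<le> \<rho> n powr (1 / real (Suc n))"
            using V(2)[of n] \<rho>1 by (intro powr_mono') auto
          then have "2 powr s * real (card (V n)) * \<rho> n powr s
              \<le> 2 powr s * real (card (V n)) * \<rho> n powr (1 / real (Suc n))"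
            by (intro mult_left_mono) auto
          then have "real (card (V n)) * (2 powr s * \<rho> n powr s)
              \<le> 2 powr s * (real (card (V n)) * \<rho> n powr (1 / real (Suc n)))"
            by (simp only: mult_ac)
          also have "\<dots> \<le> 2 powr s * (1/4) ^ n" using V(4)[of n] by (intro mult_left_mono) auto
          \<comment> \<open>One factor (1/2)^n is weakened to (1/2)^m, which tends to 0; the other
            is summed over \<open>n\<close>.\<close>
          also have "(1/4::real) ^ n = (1/2) ^ n * (1/2) ^ n" by (simp add: power_mult_distrib[symmetric])
          also have "2 powr s * ((1/2) ^ n * (1/2) ^ n) \<le> 2 powr s * ((1/2) ^ m * (1/2) ^ n)"
            using True by (intro mult_left_mono mult_right_mono power_decreasing) auto
          finally have le: "real (card (V n)) * (2 powr s * \<rho> n powr s) \<le> 2 powr s * (1/2) ^ m * (1/2) ^ n"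
            by simp
          have "(\<Sum>i<card (V n). ennreal (diameter (U (n, i)) powr s))
              = (\<Sum>i<card (V n). ennreal (2 powr s * \<rho> n powr s))"
            using True V(2)[of n] by (intro sum.cong) (auto simp: U_def powr_mult)
          also have "\<dots> = ennreal (real (card (V n)) * (2 powr s * \<rho> n powr s))"
            by (simp add: ennreal_mult ennreal_of_nat_eq_real_of_nat)
          also have "\<dots> \<le> ennreal (2 powr s * (1/2) ^ m * (1/2) ^ n)" using le by (rule ennreal_leI)
          finally show ?thesis .
        next
          case False
          then have "diameter (U (n, i)) powr s = 0" for i by (simp add: U_def)
          then show ?thesis by simp
        qed
        finally show "(\<Sum>i. ennreal (diameter (U (n, i)) powr s)) \<le> ennreal (2 powr s * (1/2) ^ m * (1/2) ^ n)" .
      qed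
      also have "\<dots> = ennreal (2 powr s * (1/2) ^ m * 2)"
        using geometric_sums[of "1/2::real"] by (intro suminf_ennreal_eq sums_mult) auto
      finally show ?case by (simp add: mult_ac)
    qed
    moreover have "(\<lambda>m. ennreal (2 powr s * 2 * (1/2) ^ m)) \<longlonglongrightarrow> 0"
      using tendsto_ennrealI[OF tendsto_mult_right_zero[OF lim2, of "2 powr s * 2"]] by simp
    ultimately have "hausdorff_premeasure s \<delta> B \<le> 0"
      using tendsto_lowerbound[of "\<lambda>m. ennreal (2 powr s * 2 * (1/2) ^ m)" 0 sequentially] by simp
    then show ?thesis by simp
  qed
  have "hausdorff_measure s B = 0" if "0 < s" for s
    unfolding hausdorff_measure_def using pre[OF that] by (auto intro!: antisym SUP_least)
  then have "hausdorff_dim B = Inf (ereal ` {0<..})"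
    unfolding hausdorff_dim_def by (intro arg_cong[of _ _ Inf] image_cong) auto
  also have "\<dots> = 0"
  proof (rule antisym)
    show "Inf (ereal ` {0<..}) \<le> 0"
    proof (rule dense_ge)
      fix e :: ereal assume "0 < e"
      then show "Inf (ereal ` {0<..}) \<le> e" by (cases e) (auto intro: Inf_lower)
    qed
    show "0 \<le> Inf (ereal ` {0<..})" by (auto intro!: Inf_greatest)
  qed
  finally show ?thesis unfolding B_def .
qed

section \<open>Dense open sets of step-like functions\<close>

lemma ex_small_radius:
  assumes "0 < a" "0 < b" "0 < c"
  shows "\<exists>\<rho>>0. \<rho> \<le> b \<and> real N * \<rho> powr a \<le> c"
proof -
  \<comment> \<open>The second term solves (N + 1) \<rho>^a = c; adding 1 avoids division by
    zero.\<close>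
  define \<rho> where "\<rho> = min b ((c / (real N + 1)) powr (1 / a))"
  have "0 < \<rho>" using assms by (simp add: \<rho>_def)
  have "\<rho> powr a \<le> ((c / (real N + 1)) powr (1 / a)) powr a"
    using assms \<open>0 < \<rho>\<close> by (intro powr_mono2) (auto simp: \<rho>_def)
  also have "\<dots> = c / (real N + 1)" using assms by (simp add: powr_powr)
  finally have "real N * \<rho> powr a \<le> real N * (c / (real N + 1))" by (intro mult_left_mono) auto
  also have "\<dots> \<le> c" using assms by (simp add: field_simps)
  finally show ?thesis using \<open>0 < \<rho>\<close> by (intro exI[of _ \<rho>]) (auto simp: \<rho>_def)
qed

text \<open>
  The bound \<open>(1/4) ^ n\<close> with exponent \<open>1 / Suc n\<close> is what makes the limsup of the balls have
  dimension zero; \<open>\<rho>\<close> can be chosen only after the finite set \<open>V\<close> of values is known.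
\<close>

definition step_scale :: "nat \<Rightarrow> real \<Rightarrow> real set \<Rightarrow> real \<Rightarrow> bool" where
  "step_scale n \<eta> V \<rho> \<longleftrightarrow> 0 < \<eta> \<and> \<eta> \<le> (1/2) ^ n \<and> finite V \<and> 0 < \<rho> \<and> \<rho> \<le> (1/2) ^ n \<and>
     real (card V) * \<rho> powr (1 / real (Suc n)) \<le> (1/4) ^ n"

text \<open>Values in open balls around \<open>V\<close>, rather than in \<open>V\<close> itself,
  make this an open condition on a compact set.\<close>

definition step_like_funs :: "(real ^ 'd) set \<Rightarrow> (real ^ 'd) set \<Rightarrow> nat \<Rightarrow> (real ^ 'd \<Rightarrow> real) set" where
  "step_like_funs \<Omega> K n = {f \<in> cont_funs \<Omega>. \<exists>\<eta> V \<rho>. step_scale n \<eta> V \<rho> \<and>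
     f ` (K - grid_level \<eta> (\<eta> ^ (1 + n * CARD('d))) (Suc 0)) \<subseteq> (\<Union>v\<in>V. ball v \<rho>)}"

text \<open>For fixed parameters the condition defines a subbasic set; the union over all admissible
  parameters is open.\<close>

lemma openin_step_like_funs:
  fixes \<Omega> :: "(real ^ 'd) set"
  assumes "compact K" "K \<subseteq> \<Omega>"
  shows "openin (compact_open_topology \<Omega>) (step_like_funs \<Omega> K n)"
proof -
  define W where "W = (\<lambda>(\<eta>, V :: real set, \<rho>). {f \<in> cont_funs \<Omega>.
    f ` (K - grid_level \<eta> (\<eta> ^ (1 + n * CARD('d))) (Suc 0)) \<subseteq> (\<Union>v\<in>V. ball v (\<rho>::real))})"
  have "openin (compact_open_topology \<Omega>) (W p)" for p
    unfolding compact_open_topology_def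
  proof (rule topology_generated_by_Basis)
    obtain \<eta> V \<rho> where p: "p = (\<eta>, V, \<rho>)" by (cases p)
    have "compact (K - grid_level \<eta> (\<eta> ^ (1 + n * CARD('d))) (Suc 0))"
      using assms(1) open_grid_level_1 by (rule compact_diff)
    moreover have "K - grid_level \<eta> (\<eta> ^ (1 + n * CARD('d))) (Suc 0) \<subseteq> \<Omega>" using assms(2) by blast
    moreover have "open (\<Union>v\<in>V. ball v \<rho>)" by blast
    ultimately show "W p \<in> {{f \<in> cont_funs \<Omega>. f ` K \<subseteq> U} | K U. compact K \<and> K \<subseteq> \<Omega> \<and> open U}"
      unfolding W_def p prod.case by blast
  qed
  moreover have "step_like_funs \<Omega> K n = (\<Union>p\<in>{(\<eta>, V, \<rho>). step_scale n \<eta> V \<rho>}. W p)"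
    unfolding step_like_funs_def W_def by auto
  ultimately show ?thesis by (simp only:) (rule openin_Union, blast)
qed

text \<open>The order of choices matters: the mesh from \<open>f\<close>, then the width as a power
  of the mesh, then \<open>g\<close>, its values \<open>V\<close>, and last \<rho>.\<close>

lemma step_like_funs_dense:
  fixes \<Omega> :: "(real ^ 'd) set"
  assumes "compact K" "K \<subseteq> \<Omega>" and T: "openin (compact_open_topology \<Omega>) T" "T \<noteq> {}"
  shows "T \<inter> step_like_funs \<Omega> K n \<noteq> {}"
proof -
  obtain f where f: "f \<in> T" using T by blast
  then have cont: "continuous_on \<Omega> f"
    using openin_subset[OF T(1)] by (auto simp: cont_funs_def)
  obtain C \<epsilon> where C: "compact C" "C \<subseteq> \<Omega>" "0 < \<epsilon>"
    "\<And>g. g \<in> cont_funs \<Omega> \<Longrightarrow> (\<And>x. x \<in> C \<Longrightarrow> dist (g x) (f x) < \<epsilon>) \<Longrightarrow> g \<in> T"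
    using compact_open_nbhd[OF T(1) f] by metis
  \<comment> \<open>Closeness to \<open>f\<close> on \<open>C\<close> keeps \<open>g\<close> in
    \<open>T\<close>; finitely many values off the grid on \<open>K\<close> make it
    step-like.\<close>
  have "compact (C \<union> K)" "C \<union> K \<subseteq> \<Omega>" "(0::real) < (1/2) ^ n"
    using C assms by (simp_all add: compact_Un)
  note approx = approx_finite_valued_off_grid[OF this(1,2) cont C(3) this(3)]
  obtain \<eta> where \<eta>: "0 < \<eta>" "\<eta> \<le> (1/2) ^ n"
    "\<forall>\<tau>>0. \<exists>g\<in>cont_funs \<Omega>. finite (g ` (C \<union> K - grid_level \<eta> \<tau> (Suc 0))) \<and>
       (\<forall>x\<in>C \<union> K. dist (g x) (f x) < \<epsilon>)"
    by (rule approx)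
  define \<tau> where "\<tau> = \<eta> ^ (1 + n * CARD('d))"
  have "0 < \<tau>" using \<eta>(1) by (simp add: \<tau>_def)
  then obtain g where g: "g \<in> cont_funs \<Omega>" "finite (g ` (C \<union> K - grid_level \<eta> \<tau> (Suc 0)))"
      "\<forall>x\<in>C \<union> K. dist (g x) (f x) < \<epsilon>"
    using \<eta>(3) by blast
  define V where "V = g ` (K - grid_level \<eta> \<tau> (Suc 0))"
  have "finite V" unfolding V_def by (rule finite_subset[OF _ g(2)]) blast
  moreover obtain \<rho> where \<rho>: "0 < \<rho>" "\<rho> \<le> (1/2) ^ n" "real (card V) * \<rho> powr (1 / real (Suc n)) \<le> (1/4) ^ n"
    using ex_small_radius[of "1 / real (Suc n)" "(1/2) ^ n" "(1/4) ^ n" "card V"] by auto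
  ultimately have "step_scale n \<eta> V \<rho>" using \<eta> by (simp add: step_scale_def)
  moreover have "g ` (K - grid_level \<eta> \<tau> (Suc 0)) \<subseteq> (\<Union>v\<in>V. ball v \<rho>)"
    unfolding V_def using \<rho>(1) by force
  ultimately have "g \<in> step_like_funs \<Omega> K n"
    unfolding step_like_funs_def \<tau>_def using g(1) by blast
  moreover have "g \<in> T" using C(4) g(1,3) by blast
  ultimately show ?thesis by blast
qed

section \<open>Exceptional sets of a typical function\<close>

theorem theorem1p3:
  fixes \<Omega> :: "(real ^ 'd) set"
  assumes "locally compact \<Omega>"
  shows "\<exists>\<F> :: (real ^ 'd \<Rightarrow> real) set.
           comeager_in (compact_open_topology \<Omega>) \<F> \<and>
           (\<forall>f\<in>\<F>. \<exists>(A :: (real ^ 'd) set) (B :: real set).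
              A \<subseteq> \<Omega> \<and>
              sigma_strongly_porous A \<and>
              lower_packing_dim A \<le> ereal (real CARD('d) - 1) \<and>
              hausdorff_dim B = 0 \<and>
              {(x, f x) | x. x \<in> \<Omega>} \<subseteq> (A \<times> UNIV) \<union> (\<Omega> \<times> B))"
proof -
  obtain K where K: "\<And>n. compact (K n)" "incseq K" "(\<Union>n. K n) = \<Omega>"
    using sigma_compact_if_locally_compact[OF assms] by metis
  then have K\<Omega>: "K n \<subseteq> \<Omega>" for n by blast
  show ?thesis
  proof (rule exI, intro conjI ballI)
    \<comment> \<open>The same \<open>n\<close> indexes the compact set and the scale: each point of
      \<Omega> is seen at all large scales.\<close>
    show "comeager_in (compact_open_topology \<Omega>) (\<Inter>n. step_like_funs \<Omega> (K n) n)"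
      using K(1) K\<Omega> by (intro comeager_in_INT openin_step_like_funs step_like_funs_dense)
  next
    fix f assume "f \<in> (\<Inter>n. step_like_funs \<Omega> (K n) n)"
    then have "\<exists>\<eta> V \<rho>. step_scale n \<eta> V \<rho> \<and>
        f ` (K n - grid_level \<eta> (\<eta> ^ (1 + n * CARD('d))) (Suc 0)) \<subseteq> (\<Union>v\<in>V. ball v \<rho>)"
      for n by (simp add: step_like_funs_def)
    then obtain \<eta> V \<rho> where scale: "\<And>n. step_scale n (\<eta> n) (V n) (\<rho> n)"
      and f: "\<And>n. f ` (K n - grid_level (\<eta> n) (\<eta> n ^ (1 + n * CARD('d))) (Suc 0))
        \<subseteq> (\<Union>v\<in>V n. ball v (\<rho> n))"
      by metis
    define B where "B = {y. \<exists>\<^sub>F n in sequentially. y \<in> (\<Union>v\<in>V n. ball v (\<rho> n))}"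
    \<comment> \<open>With this choice the graph is covered by construction; what remains is to show
      that \<open>A\<close> is small.\<close>
    define A where "A = {x \<in> \<Omega>. f x \<notin> B}"
    have \<eta>: "\<And>n. 0 < \<eta> n" "\<And>n. \<eta> n \<le> (1/2) ^ n"
      using scale unfolding step_scale_def by blast+
    have A: "\<forall>\<^sub>F n in sequentially. x \<in> grid_level (\<eta> n) (\<eta> n ^ (1 + n * CARD('d))) (Suc 0)"
      if x: "x \<in> A" for x
    proof -
      obtain m where "x \<in> K m" using x K(3) unfolding A_def by blast
      then have "x \<in> K n" if "m \<le> n" for n using incseqD[OF K(2) that] by blast
      then have "\<forall>\<^sub>F n in sequentially. x \<in> K n" unfolding eventually_sequentially by blast
      moreover have "\<forall>\<^sub>F n in sequentially. f x \<notin> (\<Union>v\<in>V n. ball v (\<rho> n))"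
        using x unfolding A_def B_def by (simp add: frequently_def)
      \<comment> \<open>A point of \<open>K n\<close> whose value misses all balls of stage
        \<open>n\<close> must lie in the removed grid neighbourhood.\<close>
      ultimately show ?thesis
        by eventually_elim (use f in blast)
    qed
    have "hausdorff_dim B = 0"
      unfolding B_def using scale by (intro hausdorff_dim_limsup_balls) (simp_all add: step_scale_def)
    moreover have "{(x, f x) | x. x \<in> \<Omega>} \<subseteq> (A \<times> UNIV) \<union> (\<Omega> \<times> B)"
      by (auto simp: A_def)
    moreover have "A \<subseteq> \<Omega>" by (auto simp: A_def)
    ultimately show "\<exists>A B. A \<subseteq> \<Omega> \<and> sigma_strongly_porous A \<and>
        lower_packing_dim A \<le> ereal (real CARD('d) - 1) \<and> hausdorff_dim B = 0 \<and>
        {(x, f x) | x. x \<in> \<Omega>} \<subseteq> (A \<times> UNIV) \<union> (\<Omega> \<times> B)"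
      using sigma_strongly_porous_grid_levels[OF \<eta> A] lower_packing_dim_grid_levels[OF \<eta> A] by blast
  qed
qed

end
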